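(* Let $R$ be a commutative ring with identity. If $R$ is semilocal and $\dim(R)=1$, then $R$ is a sober ring.
   Context: $\operatorname{Spec}(R)$ denotes the set of all prime ideals of $R$ and $\operatorname{Max}(R)$ the set of all maximal ideals of $R$. The Krull dimension $\dim(R)$ is the supremum of the lengths $k$ of finite strictly ascending chains $P_0\subset P_1\subset\cdots\subset P_k$ of prime ideals of $R$. A ring is called semilocal if it has only finitely many maximal ideals. A commutative ring $R$ with identity is called a sober ring if for every $P\in\operatorname{Spec}(R)$ with $P\notin\operatorname{Max}(R)$ one has \[ P\neq \bigcap_{Q\in\operatorname{Spec}(R),\ P\subsetneq Q} Q . \] (This is a condition on the ideals of the ring; it is not the topological notion of a sober space.) *)

theory Defs
  imports "HOL-Algebra.Ideal" "HOL-Library.Extended_Real"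
begin

definition Spec :: "('a, 'm) ring_scheme \<Rightarrow> 'a set set" where
  "Spec R = {P. primeideal P R}"

definition Max_ideals :: "('a, 'm) ring_scheme \<Rightarrow> 'a set set" where
  "Max_ideals R = {M. maximalideal M R}"

definition prime_chain :: "('a, 'm) ring_scheme \<Rightarrow> nat \<Rightarrow> (nat \<Rightarrow> 'a set) \<Rightarrow> bool" where
  "prime_chain R k P \<longleftrightarrow> (\<forall>i\<le>k. P i \<in> Spec R) \<and> (\<forall>i<k. P i \<subset> P (Suc i))"

(* A chain P 0 < ... < P k has length k. The supremum is taken in the extended
   reals, so it may be infinite, and the zero ring gets dimension -\<infinity>. *)
definition krull_dim :: "('a, 'm) ring_scheme \<Rightarrow> ereal" where
  "krull_dim R = (SUP k \<in> {k. \<exists>P. prime_chain R k P}. ereal (real k))"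

definition semilocal :: "('a, 'm) ring_scheme \<Rightarrow> bool" where
  "semilocal R \<longleftrightarrow> finite (Max_ideals R)"

(* The family that is intersected is never empty: a non-maximal prime ideal is
   properly contained in some maximal ideal. *)
definition sober_ring :: "('a, 'm) ring_scheme \<Rightarrow> bool" where
  "sober_ring R \<longleftrightarrow>
     cring R \<and> (\<forall>P \<in> Spec R. P \<notin> Max_ideals R \<longrightarrow> P \<noteq> \<Inter>{Q \<in> Spec R. P \<subset> Q})"

end

(* In a one-dimensional ring the primes strictly above a non-maximal prime P are all
   maximal, since otherwise Krull's maximal ideal theorem would give a chain of length 2.
   If the ring is semilocal, there are only finitely many of them, so if they intersected
   in P, primality would force one of them to lie inside P (prime avoidance for
   intersections). *)

theory Submission
  imports Defs "HOL-Algebra.Ring_Divisibility"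
begin

text \<open>Zorn's lemma, applied to the ideals above \<open>I\<close> that omit \<one>. For an
  ideal, omitting \<one> amounts to being proper, but in this form the condition visibly passes to
  unions of chains.\<close>

lemma (in cring) exists_maximalideal_superset:
  assumes I: "ideal I R" "I \<noteq> carrier R"
  obtains M where "maximalideal M R" "I \<subseteq> M"
proof -
  define A where "A = {J. ideal J R \<and> I \<subseteq> J \<and> \<one> \<notin> J}"
  have IA: "I \<in> A"
    using I ideal.one_imp_carrier by (auto simp: A_def)
  have "\<exists>M\<in>A. \<forall>X\<in>A. M \<subseteq> X \<longrightarrow> X = M"
  proof (rule subset_Zorn_nonempty)
    show "A \<noteq> {}"
      using IA by blast
    fix C assume C: "C \<noteq> {}" "subset.chain A C"
    then have sub: "C \<subseteq> A"
      by (simp add: subset_chain_def)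
    then have "subset.chain {J. ideal J R} C"
      using C(2) by (auto simp: subset_chain_def A_def)
    then have "ideal (\<Union>C) R"
      using chain_Union_is_ideal[of C] C(1) by simp
    then show "\<Union>C \<in> A"
      using sub C(1) by (auto simp: A_def)
  qed
  then obtain M where M: "M \<in> A" "\<And>X. X \<in> A \<Longrightarrow> M \<subseteq> X \<Longrightarrow> X = M"
    by blast
  have "maximalideal M R"
  proof (rule maximalidealI)
    show "ideal M R" "carrier R \<noteq> M"
      using M(1) by (auto simp: A_def)
    fix J assume J: "ideal J R" "M \<subseteq> J" "J \<subseteq> carrier R"
    show "J = M \<or> J = carrier R"
    \<comment> \<open>Maximality in \<open>A\<close> becomes maximality among all proper ideals: an
      ideal above \<open>M\<close> either contains \<one> and is everything, or belongs to
      \<open>A\<close>.\<close>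
    proof (cases "\<one> \<in> J")
      case True
      then show ?thesis
        using ideal.one_imp_carrier[OF J(1)] by blast
    next
      case False
      then have "J \<in> A"
        using J M(1) by (auto simp: A_def)
      then show ?thesis
        using M(2) J(2) by blast
    qed
  qed
  then show thesis
    using that M(1) by (auto simp: A_def)
qed

text \<open>Induction on \<open>F\<close>: if \<open>Q\<close> is not inside \<open>I\<close>, pick
  \<open>a\<close> in \<open>Q\<close> outside \<open>I\<close>. For \<open>b\<close> in the
  intersection of the other members, \<open>a \<otimes> b\<close> lies in all of them and in
  \<open>Q\<close>, hence in \<open>I\<close>, so primality puts \<open>b\<close> in
  \<open>I\<close> and the induction hypothesis applies.\<close>

lemma (in primeideal) finite_Inter_subset_imp_subset:
  assumes "finite F" "F \<noteq> {}" "\<And>Q. Q \<in> F \<Longrightarrow> ideal Q R" "\<Inter>F \<subseteq> I"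
  shows "\<exists>Q\<in>F. Q \<subseteq> I"
  using assms
proof (induction F rule: finite_ne_induct)
  case (singleton Q)
  then show ?case by simp
next
  case (insert Q F)
  show ?case
  proof (cases "Q \<subseteq> I")
    case False
    then obtain a where a: "a \<in> Q" "a \<notin> I"
      by blast
    have idQ: "ideal Q R" and idF: "\<And>J. J \<in> F \<Longrightarrow> ideal J R"
      using insert.prems(1) by auto
    have aR: "a \<in> carrier R"
      using idQ a(1) ideal.Icarr by metis
    have "b \<in> I" if b: "b \<in> \<Inter>F" for b
    proof -
      \<comment> \<open>Here \<open>F\<close> must be nonempty: the empty intersection is not
        confined to the carrier.\<close>
      have bR: "b \<in> carrier R"
        using b insert.hyps(2) idF ideal.Icarr by (metis InterE ex_in_conv)
      have "a \<otimes> b \<in> Q"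
        using ideal.I_r_closed[OF idQ a(1) bR] .
      moreover have "a \<otimes> b \<in> \<Inter>F"
        using ideal.I_l_closed[OF idF _ aR] b by blast
      ultimately have "a \<otimes> b \<in> I"
        using insert.prems(2) by auto
      then show "b \<in> I"
        using I_prime[OF aR bR] a(2) by blast
    qed
    then show ?thesis
      using insert.IH idF by blast
  qed auto
qed

lemma krull_dim_ge:
  assumes "prime_chain R k P"
  shows "ereal (real k) \<le> krull_dim R"
  unfolding krull_dim_def using assms by (intro SUP_upper) auto

lemma prime_above_nonmaximal_imp_maximal:
  fixes R (structure)
  assumes R: "cring R" "krull_dim R \<le> 1"
    and P: "primeideal P R" and Q: "primeideal Q R" "P \<subset> Q"
  shows "maximalideal Q R"
proof (rule ccontr)
  assume nmax: "\<not> maximalideal Q R"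
  interpret cring R by fact
  have "ideal Q R" "Q \<noteq> carrier R"
    using primeideal.axioms(1)[OF Q(1)] primeideal.I_notcarr[OF Q(1)] by auto
  then obtain M where M: "maximalideal M R" "Q \<subseteq> M"
    using exists_maximalideal_superset by metis
  with nmax have "Q \<subset> M"
    by blast
  moreover have "primeideal M R"
    using maximalideal_prime[OF M(1)] .
  \<comment> \<open>Length counts inclusions, so these three primes give length 2, above the
    dimension bound.\<close>
  ultimately have "prime_chain R 2 (\<lambda>i. if i = 0 then P else if i = 1 then Q else M)"
    using P Q by (auto simp: prime_chain_def Spec_def less_2_cases_iff)
  from krull_dim_ge[OF this] have "ereal (real 2) \<le> 1"
    using R(2) order_trans by blast
  then show False
    by simp
qed

theorem proposition2p4:
  fixes R :: "('a, 'm) ring_scheme"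
  assumes "cring R"
    and "semilocal R"
    and "krull_dim R = 1"
  shows "sober_ring R"
  unfolding sober_ring_def
proof (intro conjI ballI impI notI)
  show "cring R" by fact
  fix P
  assume "P \<in> Spec R"
    and eq: "P = \<Inter>{Q \<in> Spec R. P \<subset> Q}"
  then interpret primeideal P R
    by (simp add: Spec_def)
  let ?F = "{Q \<in> Spec R. P \<subset> Q}"
  have "?F \<subseteq> Max_ideals R"
    using prime_above_nonmaximal_imp_maximal[OF assms(1) _ primeideal_axioms] assms(3)
    by (auto simp: Spec_def Max_ideals_def)
  then have "finite ?F"
    using assms(2) finite_subset by (auto simp: semilocal_def)
  moreover have "?F \<noteq> {}"
    \<comment> \<open>The empty intersection is \<open>UNIV\<close>, which is not contained in a proper ideal.\<close>
  proof
    assume "?F = {}"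
    with eq have "P = \<Inter>{}"
      by (rule subst[rotated])
    then show False
      using I_notcarr a_subset by auto
  qed
  moreover have "ideal Q R" if "Q \<in> ?F" for Q
    using that primeideal.axioms(1) by (auto simp: Spec_def)
  \<comment> \<open>By \<open>eq\<close> the intersection lies in \<open>P\<close>, so some member
    of the family does too, although each member strictly contains \<open>P\<close>.\<close>
  ultimately have "\<exists>Q\<in>?F. Q \<subseteq> P"
    using eq by (intro finite_Inter_subset_imp_subset) auto
  then show False
    by blast
qed

end
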